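(* Let $D\in\mathbb{N}$ with $D\ge 3$, let $d\in\mathbb{N}$ with $d\ge3$ and let $\varrho\in[0,1)$ be arbitrary. Then there exist $N\in\mathbb{N}$, a matrix $A\in\mathbb{R}^{N\times d}$ and $y\in\mathbb{R}^N$ such that the following holds. 1. There is a unique minimizer $g^*\in\mathbb{R}^d$ of $\min_{x:Ax=y}\|x\|_{\ell^1}$, and the null space property constant $\varrho(A,g^* )$ corresponding to $A$ and $g^*$ is equal to the given $\varrho$. 2. With $\mathcal{S}=\operatorname{supp}(g^* )$, $\mathcal{S}^c=\{1,\dots,d\}\setminus\mathcal{S}$ and $\tilde\varrho=\tilde\varrho(A,g^* )$ the other null space property constant corresponding to $A$ and $g^*$, $$\lim_{\alpha\downarrow0}\frac{\|x^\infty(\alpha)-g^*\|_{\ell^1}}{\alpha\,|\mathcal{S}^c|\,(1+\tilde\varrho)}=h_D(\varrho) \qquad\text{and}\qquad \lim_{\alpha\downarrow0}\frac{\|(x^\infty(\alpha))_{\mathcal{S}^c}-g^*_{\mathcal{S}^c}\|_{\ell^\infty}}{\alpha}=h_D(\varrho).$$ Here $x^\infty(\alpha)$ denotes, for $\alpha>0$, the unique minimizer of $\min_{x:Ax=y}D_{Q^D_\alpha}(x,0)$.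
   Context: For $x\in\mathbb{R}^d$ and $T\subset\{1,\dots,d\}$, $x_T=(x_i)_{i\in T}$ and $\operatorname{supp}(x)=\{i: x_i\ne 0\}$. For a differentiable strictly convex $F$, $D_F(p,q)=F(p)-F(q)-\langle\nabla F(q),p-q\rangle$. For an integer $D\ge3$, $$h_D:(-1,1)\to\mathbb{R},\quad h_D(z)=(1-z)^{-\frac{D}{D-2}}-(1+z)^{-\frac{D}{D-2}},$$ which is an increasing bijection onto $\mathbb{R}$ with inverse $h_D^{-1}$; $q_D(u)=\int_0^u h_D^{-1}(v)\,dv$; and $Q^D_\alpha(z)=\sum_{i=1}^d\alpha\,q_D(z_i/\alpha)$ for $z\in\mathbb{R}^d$, $\alpha>0$. If $g^*\neq 0$ is the unique minimizer of $\min_{x:Ax=y}\|x\|_{\ell^1}$, $\ker A\ne\{0\}$ and $\mathcal{S}=\operatorname{supp}(g^* )$, then $$\varrho(A,g^* )=\sup_{0\ne n\in\ker A}\frac{-\sum_{i\in\mathcal{S}}\operatorname{sign}(g^*_i)n_i}{\|n_{\mathcal{S}^c}\|_{\ell^1}},\qquad \tilde\varrho(A,g^* )=\sup_{0\ne n\in\ker A}\frac{\|n_{\mathcal{S}}\|_{\ell^1}}{\|n_{\mathcal{S}^c}\|_{\ell^1}}.$$ *)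

theory Defs
  imports "Jordan_Normal_Form.Matrix_Kernel" "HOL-Analysis.Analysis"
begin

text \<open>Vectors and matrices are those of \<open>Jordan_Normal_Form.Matrix\<close>, so indices run over
  \<open>{..<d}\<close> instead of \<open>{1..d}\<close>. As \<open>HOL-Analysis\<close> has its own type \<open>vec\<close> and its own
  notations for components and inner products, they are switched off here.\<close>

hide_type (open) Finite_Cartesian_Product.vec
hide_const (open) Finite_Cartesian_Product.vec
no_notation Finite_Cartesian_Product.vec_nth (infixl "$" 90)
no_notation Inner_Product.real_inner_class.inner (infix "\<bullet>" 70)

definition supp :: "real vec \<Rightarrow> nat set" where
  "supp x = {i. i < dim_vec x \<and> x $ i \<noteq> 0}"

text \<open>Norms of the restricted vector \<open>x\<^sub>T = (x\<^sub>i)\<^bsub>i\<in>T\<^esub>\<close>, for \<open>T \<subseteq> {..<dim_vec x}\<close>.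
  The inserted 0 only matters for \<open>T = {}\<close>.\<close>

definition l1_norm_on :: "nat set \<Rightarrow> real vec \<Rightarrow> real" where
  "l1_norm_on T x = (\<Sum>i\<in>T. \<bar>x $ i\<bar>)"

definition linf_norm_on :: "nat set \<Rightarrow> real vec \<Rightarrow> real" where
  "linf_norm_on T x = Max (insert 0 ((\<lambda>i. \<bar>x $ i\<bar>) ` T))"

definition l1_norm :: "real vec \<Rightarrow> real" where
  "l1_norm x = l1_norm_on {..<dim_vec x} x"

definition unique_arg_min :: "('a \<Rightarrow> real) \<Rightarrow> ('a \<Rightarrow> bool) \<Rightarrow> 'a \<Rightarrow> bool" where
  "unique_arg_min f P x \<longleftrightarrow> is_arg_min f P x \<and> (\<forall>z. is_arg_min f P z \<longrightarrow> z = x)"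

definition solves :: "real mat \<Rightarrow> real vec \<Rightarrow> real vec \<Rightarrow> bool" where
  "solves A y x \<longleftrightarrow> x \<in> carrier_vec (dim_col A) \<and> A *\<^sub>v x = y"

text \<open>The vector of partial derivatives, i.e. the gradient for differentiable \<open>F\<close>.\<close>

definition grad :: "(real vec \<Rightarrow> real) \<Rightarrow> real vec \<Rightarrow> real vec" where
  "grad F q = Matrix.vec (dim_vec q)
     (\<lambda>i. deriv (\<lambda>t. F (q + t \<cdot>\<^sub>v unit_vec (dim_vec q) i)) 0)"

definition bregman :: "(real vec \<Rightarrow> real) \<Rightarrow> real vec \<Rightarrow> real vec \<Rightarrow> real" where
  "bregman F p q = F p - F q - grad F q \<bullet> (p - q)"

definition h_fun :: "nat \<Rightarrow> real \<Rightarrow> real" where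
  "h_fun D z = (1 - z) powr (- (real D / (real D - 2))) - (1 + z) powr (- (real D / (real D - 2)))"

definition h_inv :: "nat \<Rightarrow> real \<Rightarrow> real" where
  "h_inv D = inv_into {-1<..<1} (h_fun D)"

text \<open>The interval integral is oriented, as needed for \<open>u < 0\<close>.\<close>

definition q_fun :: "nat \<Rightarrow> real \<Rightarrow> real" where
  "q_fun D u = (LBINT v=ereal 0..ereal u. h_inv D v)"

definition Q_fun :: "nat \<Rightarrow> real \<Rightarrow> real vec \<Rightarrow> real" where
  "Q_fun D \<alpha> z = (\<Sum>i<dim_vec z. \<alpha> * q_fun D (z $ i / \<alpha>))"

text \<open>The null space property constants. They are meant for a nonzero unique minimizer \<open>g\<close> of the
  \<open>\<ell>\<^sup>1\<close> norm subject to \<open>A x = A g\<close> and a nontrivial kernel; then the denominators are nonzero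
  and the suprema are taken over nonempty, bounded sets of reals.\<close>

definition nsp_const :: "real mat \<Rightarrow> real vec \<Rightarrow> real" where
  "nsp_const A g =
     (SUP n \<in> mat_kernel A - {0\<^sub>v (dim_col A)}.
        - (\<Sum>i\<in>supp g. sgn (g $ i) * n $ i) / l1_norm_on ({..<dim_vec g} - supp g) n)"

definition nsp_const_abs :: "real mat \<Rightarrow> real vec \<Rightarrow> real" where
  "nsp_const_abs A g =
     (SUP n \<in> mat_kernel A - {0\<^sub>v (dim_col A)}.
        l1_norm_on (supp g) n / l1_norm_on ({..<dim_vec g} - supp g) n)"

end

theory Submission
  imports Defs
begin

text \<open>Take \<open>A\<close> with kernel spanned by \<open>n = (-\<rho>(d - 1), 1, \<dots>, 1)\<close> and \<open>g\<^sup>* = (1, 0, \<dots>, 0)\<close>, so that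
  both null space constants equal \<open>\<rho>\<close>. The feasible points are \<open>g\<^sup>* + t n\<close>, and the optimality
  condition along this line is \<open>h\<^sup>-\<^sup>1(t/\<alpha>) = \<rho> h\<^sup>-\<^sup>1((1 - \<rho>(d - 1)t)/\<alpha>)\<close>. Its solution satisfies
  \<open>0 \<le> t/\<alpha> \<le> h(\<rho>)\<close>; hence the argument on the right tends to infinity, the right-hand side to \<open>\<rho>\<close>,
  and \<open>t/\<alpha>\<close> to \<open>h(\<rho>)\<close>.\<close>

section \<open>The function \<open>h\<^sub>D\<close> and its inverse\<close>

lemma h_fun_exponent_pos: "D \<ge> 3 \<Longrightarrow> real D / (real D - 2) > 0"
  by simp

lemma h_fun_zero [simp]: "h_fun D 0 = 0"
  by (simp add: h_fun_def)

lemma h_fun_minus: "h_fun D (- z) = - h_fun D z"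
  by (simp add: h_fun_def)

lemma h_fun_strict_mono:
  assumes "D \<ge> 3" "-1 < x" "x < y" "y < 1"
  shows "h_fun D x < h_fun D y"
proof -
  note p = h_fun_exponent_pos[OF assms(1)]
  have "(1 - x) powr - (real D / (real D - 2)) < (1 - y) powr - (real D / (real D - 2))"
    using assms p by (intro powr_less_mono2_neg) auto
  moreover have "(1 + y) powr - (real D / (real D - 2)) < (1 + x) powr - (real D / (real D - 2))"
    using assms p by (intro powr_less_mono2_neg) auto
  ultimately show ?thesis
    by (simp add: h_fun_def)
qed

lemma isCont_h_fun: "-1 < x \<Longrightarrow> x < 1 \<Longrightarrow> isCont (h_fun D) x"
  unfolding h_fun_def by (intro continuous_intros) auto

lemma h_fun_inj_on: "D \<ge> 3 \<Longrightarrow> inj_on (h_fun D) {-1<..<1}"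
  by (intro strict_mono_on_imp_inj_on strict_mono_onI h_fun_strict_mono) auto

text \<open>On [0, 1) the first power blows up while the second stays at most 1, so some z has
  \<open>h_fun D z\<close> \<ge> y, and the intermediate value theorem on [0, z] hits y exactly.
  Negative values then follow by oddness.\<close>

lemma h_fun_surj_nonneg:
  assumes "D \<ge> 3" "y \<ge> 0"
  shows "\<exists>z. 0 \<le> z \<and> z < 1 \<and> h_fun D z = y"
proof -
  define p where "p = real D / (real D - 2)"
  have p: "p > 0"
    using h_fun_exponent_pos[OF assms(1)] by (simp add: p_def)
  \<comment> \<open>Obtained by solving (1 - z) powr (- p) = y + 1; the extra 1 compensates for the
    subtracted term (1 + z) powr (- p) \<le> 1.\<close>
  define z where "z = 1 - (y + 1) powr (- (1 / p))"
  have z0: "0 \<le> z"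
    using assms p unfolding z_def by (simp add: powr_minus ge_one_powr_ge_zero inverse_le_1_iff)
  have z1: "z < 1"
    using assms unfolding z_def by simp
  have "(1 - z) powr (- p) = y + 1"
    using assms p by (simp add: z_def powr_powr)
  moreover have "(1 + z) powr (- p) \<le> 1"
    using z0 p by (simp add: powr_minus ge_one_powr_ge_zero inverse_le_1_iff)
  ultimately have "h_fun D z \<ge> y"
    by (simp add: h_fun_def p_def)
  moreover have "continuous_on {0..z} (h_fun D)"
    using z1 by (intro continuous_at_imp_continuous_on ballI isCont_h_fun) auto
  ultimately obtain x where "0 \<le> x" "x \<le> z" "h_fun D x = y"
    using IVT'[of "h_fun D" 0 y z] assms(2) z0 by auto
  then show ?thesis
    using z1 by (intro exI[of _ x]) auto
qed

lemma h_fun_image: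
  assumes "D \<ge> 3"
  shows "h_fun D ` {-1<..<1} = UNIV"
proof -
  have "\<exists>z\<in>{-1<..<1}. y = h_fun D z" for y
  proof (cases "y \<ge> 0")
    case True
    then obtain z where "0 \<le> z" "z < 1" "h_fun D z = y"
      using h_fun_surj_nonneg[OF assms] by blast
    then show ?thesis
      by (intro bexI[of _ z]) auto
  next
    case False
    then obtain z where "0 \<le> z" "z < 1" "h_fun D z = - y"
      using h_fun_surj_nonneg[OF assms, of "- y"] by auto
    then show ?thesis
      by (intro bexI[of _ "- z"]) (auto simp: h_fun_minus)
  qed
  then show ?thesis
    by blast
qed

lemma h_inv_bounds:
  assumes "D \<ge> 3"
  shows "-1 < h_inv D u" "h_inv D u < 1"
  using inv_into_into[of u "h_fun D" "{-1<..<1}"] h_fun_image[OF assms]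
  by (auto simp: h_inv_def)

lemma h_fun_h_inv: "D \<ge> 3 \<Longrightarrow> h_fun D (h_inv D u) = u"
  unfolding h_inv_def by (intro f_inv_into_f) (simp add: h_fun_image)

lemma h_inv_h_fun: "D \<ge> 3 \<Longrightarrow> -1 < z \<Longrightarrow> z < 1 \<Longrightarrow> h_inv D (h_fun D z) = z"
  unfolding h_inv_def by (intro inv_into_f_f h_fun_inj_on) auto

lemma h_inv_zero [simp]: "D \<ge> 3 \<Longrightarrow> h_inv D 0 = 0"
  using h_inv_h_fun[of D 0] by simp

lemma h_inv_strict_mono:
  assumes "D \<ge> 3" "u < v"
  shows "h_inv D u < h_inv D v"
proof (rule ccontr)
  assume "\<not> h_inv D u < h_inv D v"
  then consider "h_inv D u = h_inv D v" | "h_inv D v < h_inv D u"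
    by linarith
  then show False
    using h_fun_strict_mono[OF assms(1), of "h_inv D v" "h_inv D u"] h_inv_bounds[OF assms(1)]
      h_fun_h_inv[OF assms(1)] assms(2)
    by cases (metis less_irrefl, metis less_asym)
qed

lemma h_inv_mono: "D \<ge> 3 \<Longrightarrow> u \<le> v \<Longrightarrow> h_inv D u \<le> h_inv D v"
  using h_inv_strict_mono[of D u v] by (cases "u = v") auto

lemma isCont_h_inv:
  assumes "D \<ge> 3"
  shows "isCont (h_inv D) u"
proof -
  define x where "x = h_inv D u"
  have x: "-1 < x" "x < 1"
    using h_inv_bounds[OF assms] by (auto simp: x_def)
  \<comment> \<open>Half the distance from x to the boundary of (-1, 1), so that the closed e-ball
    around x stays in the domain on which \<open>h_inv\<close> is a left inverse of the continuous
    \<open>h_fun\<close>.\<close>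
  define e where "e = min (1 - x) (x + 1) / 2"
  have e: "e > 0" "e < 1 - x" "e < x + 1"
    using x by (auto simp: e_def min_def)
  have "isCont (h_inv D) (h_fun D x)"
  proof (rule isCont_inverse_function[where f = "h_fun D" and x = x and d = e])
    fix z assume "\<bar>z - x\<bar> \<le> e"
    then have z: "-1 < z" "z < 1"
      using e by linarith+
    show "h_inv D (h_fun D z) = z" "isCont (h_fun D) z"
      using h_inv_h_fun[OF assms z] isCont_h_fun[OF z] by blast+
  qed (use e in auto)
  then show ?thesis
    by (simp add: x_def h_fun_h_inv assms)
qed

lemma h_inv_tendsto_1:
  assumes "D \<ge> 3"
  shows "(h_inv D \<longlongrightarrow> 1) at_top"
proof (rule order_tendstoI)
  fix a :: real assume "a < 1"
  \<comment> \<open>The bound a may lie at or below -1, where \<open>h_fun\<close> cannot be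
    inverted; raising it to at least 0 only strengthens the claim.\<close>
  define b where "b = max a 0"
  have b: "-1 < b" "b < 1" "a \<le> b"
    using \<open>a < 1\<close> by (auto simp: b_def)
  have "a < h_inv D u" if "u > h_fun D b" for u
    using h_inv_strict_mono[OF assms that] h_inv_h_fun[OF assms b(1,2)] b(3) by simp
  then show "\<forall>\<^sub>F u in at_top. a < h_inv D u"
    by (rule eventually_mono[OF eventually_gt_at_top])
next
  fix a :: real assume "1 < a"
  then show "\<forall>\<^sub>F u in at_top. h_inv D u < a"
    using h_inv_bounds(2)[OF assms] by (intro always_eventually allI) (meson less_trans)
qed

section \<open>The potential \<open>q_fun\<close> and the Bregman divergence from the origin\<close>

lemma q_fun_zero [simp]: "q_fun D 0 = 0"
  by (simp add: q_fun_def zero_ereal_def[symmetric])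

lemma q_fun_has_derivative:
  assumes "D \<ge> 3"
  shows "(q_fun D has_real_derivative h_inv D u) (at u)"
proof -
  \<comment> \<open>An interval with both the base point 0 and u in its interior: the fundamental
    theorem of calculus gives a derivative within it, which at an interior point is the full
    derivative.\<close>
  define a b where "a = min 0 u - 1" and "b = max 0 u + 1"
  have ab: "a < 0" "0 < b" "a < u" "u < b"
    by (auto simp: a_def b_def)
  have "continuous_on {a..b} (h_inv D)"
    by (intro continuous_at_imp_continuous_on ballI isCont_h_inv assms)
  then have "((\<lambda>u. LBINT v=ereal 0..ereal u. h_inv D v) has_vector_derivative h_inv D u)
      (at u within {a..b})"
    using ab by (intro interval_integral_FTC2) auto
  then have "(q_fun D has_real_derivative h_inv D u) (at u within {a..b})"
    by (simp add: q_fun_def[abs_def] has_real_derivative_iff_has_vector_derivative)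
  then show ?thesis
    using ab by (simp add: at_within_Icc_at)
qed

lemma q_fun_has_derivative' [derivative_intros]:
  assumes "D \<ge> 3" "(f has_real_derivative f') (at x)"
  shows "((\<lambda>x. q_fun D (f x)) has_real_derivative h_inv D (f x) * f') (at x)"
  using DERIV_chain2[OF q_fun_has_derivative[OF assms(1)] assms(2)] .

text \<open>Since \<open>h_inv D 0 = 0\<close> and \<open>q_fun D 0 = 0\<close>, both the gradient
  and the value of Q vanish at the origin, so the Bregman problem just minimizes Q.\<close>

lemma bregman_Q_fun:
  assumes "D \<ge> 3" "\<alpha> > 0" "z \<in> carrier_vec d"
  shows "bregman (Q_fun D \<alpha>) z (0\<^sub>v d) = Q_fun D \<alpha> z"
proof -
  have "deriv (\<lambda>t. Q_fun D \<alpha> (0\<^sub>v d + t \<cdot>\<^sub>v unit_vec d i)) 0 = 0" if "i < d" for i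
  proof (rule DERIV_imp_deriv)
    have eq: "Q_fun D \<alpha> (0\<^sub>v d + t \<cdot>\<^sub>v unit_vec d i)
        = (\<Sum>j<d. \<alpha> * q_fun D (t * unit_vec d i $ j / \<alpha>))" for t
      by (simp add: Q_fun_def)
    show "((\<lambda>t. Q_fun D \<alpha> (0\<^sub>v d + t \<cdot>\<^sub>v unit_vec d i)) has_real_derivative 0) (at 0)"
      unfolding eq using assms(1,2) by (auto intro!: derivative_eq_intros)
  qed
  then have "grad (Q_fun D \<alpha>) (0\<^sub>v d) = 0\<^sub>v d"
    by (intro eq_vecI) (auto simp: grad_def)
  then show ?thesis
    using assms(3) by (simp add: bregman_def Q_fun_def)
qed

section \<open>The matrix\<close>

text \<open>The minimizer g, the kernel vectors and all feasible points have this shape, so every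
  computation in dimension d reduces to one with two real numbers.\<close>

definition head_vec :: "nat \<Rightarrow> real \<Rightarrow> real \<Rightarrow> real vec" where
  "head_vec d a b = Matrix.vec d (\<lambda>i. if i = 0 then a else b)"

text \<open>This is \<open>I - n e\<^sub>1\<^sup>T\<close> with \<open>n = (-c, 1, \<dots>, 1)\<close>.\<close>

definition line_mat :: "nat \<Rightarrow> real \<Rightarrow> real mat" where
  "line_mat d c = Matrix.mat d d
     (\<lambda>(i, j). (if i = j then 1 else 0) - (if j = 1 then (if i = 0 then - c else 1) else 0))"

lemma head_vec_simps [simp]:
  "dim_vec (head_vec d a b) = d"
  "head_vec d a b \<in> carrier_vec d"
  "i < d \<Longrightarrow> head_vec d a b $ i = (if i = 0 then a else b)"
  by (auto simp: head_vec_def)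

lemma head_vec_diff: "head_vec d a b - head_vec d a' b' = head_vec d (a - a') (b - b')"
  by (intro eq_vecI) auto

lemma head_vec_eq_iff:
  assumes "d \<ge> 2"
  shows "head_vec d a b = head_vec d a' b' \<longleftrightarrow> a = a' \<and> b = b'"
proof
  assume "head_vec d a b = head_vec d a' b'"
  then have "head_vec d a b $ 0 = head_vec d a' b' $ 0" "head_vec d a b $ 1 = head_vec d a' b' $ 1"
    by simp_all
  then show "a = a' \<and> b = b'"
    using assms by simp
qed simp

lemma zero_vec_eq_head_vec: "0\<^sub>v d = head_vec d 0 0"
  by (intro eq_vecI) auto

text \<open>Common source of the formulas for the l1 norm and for Q, both of which are separable
  sums over the coordinates.\<close>

lemma sum_head_vec:
  assumes "d \<ge> 1"
  shows "(\<Sum>i<d. f (head_vec d a b $ i)) = f a + (real d - 1) * (f b :: real)"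
proof -
  have "{..<d} = insert 0 {1..<d}"
    using assms by auto
  then show ?thesis
    using assms by (simp add: of_nat_diff)
qed

lemma l1_norm_head_vec: "d \<ge> 1 \<Longrightarrow> l1_norm (head_vec d a b) = \<bar>a\<bar> + (real d - 1) * \<bar>b\<bar>"
  using sum_head_vec[of d abs a b] by (simp add: l1_norm_def l1_norm_on_def)

lemma Q_fun_head_vec:
  "d \<ge> 1 \<Longrightarrow> Q_fun D \<alpha> (head_vec d a b) = \<alpha> * q_fun D (a / \<alpha>) + (real d - 1) * (\<alpha> * q_fun D (b / \<alpha>))"
  using sum_head_vec[of d "\<lambda>x. \<alpha> * q_fun D (x / \<alpha>)" a b] by (simp add: Q_fun_def)

lemma supp_head_vec: "d \<ge> 1 \<Longrightarrow> a \<noteq> 0 \<Longrightarrow> supp (head_vec d a 0) = {0}"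
  by (auto simp: supp_def split: if_splits)

lemma l1_norm_on_tail_head_vec:
  assumes "d \<ge> 1"
  shows "l1_norm_on ({..<d} - {0}) (head_vec d a b) = (real d - 1) * \<bar>b\<bar>"
proof -
  have "l1_norm_on ({..<d} - {0}) (head_vec d a b) = (\<Sum>i\<in>{..<d} - {0}. \<bar>b\<bar>)"
    unfolding l1_norm_on_def by (intro sum.cong) auto
  then show ?thesis
    using assms by (simp add: of_nat_diff)
qed

lemma linf_norm_on_tail_head_vec:
  assumes "d \<ge> 2"
  shows "linf_norm_on ({..<d} - {0}) (head_vec d a b) = \<bar>b\<bar>"
proof -
  have "1 \<in> {..<d} - {0}"
    using assms by simp
  then have "(\<lambda>i. \<bar>head_vec d a b $ i\<bar>) ` ({..<d} - {0}) = {\<bar>b\<bar>}"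
    by force
  then show ?thesis
    by (simp add: linf_norm_on_def)
qed

section \<open>Feasible set and kernel of the matrix\<close>

lemma line_mat_carrier [simp]:
  "line_mat d c \<in> carrier_mat d d" "dim_row (line_mat d c) = d" "dim_col (line_mat d c) = d"
  by (auto simp: line_mat_def)

lemma line_mat_mult_index:
  assumes "d \<ge> 2" "x \<in> carrier_vec d" "i < d"
  shows "(line_mat d c *\<^sub>v x) $ i = x $ i - x $ 1 * (if i = 0 then - c else 1)"
proof -
  have "(line_mat d c *\<^sub>v x) $ i
      = (\<Sum>j<d. (if i = j then x $ j else 0)
          - (if j = 1 then x $ j * (if i = 0 then - c else 1) else 0))"
    using assms unfolding line_mat_def
    by (auto simp: scalar_prod_def atLeast0LessThan algebra_simps intro!: sum.cong)
  then show ?thesis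
    using assms by (simp add: sum_subtractf)
qed

text \<open>As A x = x - x_1 n, a solution is the right-hand side plus a multiple of n, the free
  parameter t being the entry at index 1. Because n has entry 1 there, every t is possible. The case
  t = 0 shows that \<open>head_vec d a 0\<close> is fixed by A.\<close>

lemma line_mat_mult_eq_iff:
  assumes "d \<ge> 2"
  shows "x \<in> carrier_vec d \<and> line_mat d c *\<^sub>v x = head_vec d a 0
    \<longleftrightarrow> (\<exists>t. x = head_vec d (a - c * t) t)"
proof safe
  assume x: "x \<in> carrier_vec d" and eq: "line_mat d c *\<^sub>v x = head_vec d a 0"
  define t where "t = x $ 1"
  have "x $ i = (if i = 0 then a - c * t else t)" if "i < d" for i
    using line_mat_mult_index[OF assms x that, of c] that unfolding eq t_def[symmetric]
    by (cases "i = 0") (simp_all add: algebra_simps)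
  then have "x = head_vec d (a - c * t) t"
    using x by (intro eq_vecI) auto
  then show "\<exists>t. x = head_vec d (a - c * t) t"
    by blast
next
  fix t
  show "line_mat d c *\<^sub>v head_vec d (a - c * t) t = head_vec d a 0"
    using assms by (intro eq_vecI) (auto simp del: index_mult_mat_vec simp: line_mat_mult_index)
qed simp

lemma solves_line_mat:
  "d \<ge> 2 \<Longrightarrow> solves (line_mat d c) (head_vec d a 0) x \<longleftrightarrow> (\<exists>t. x = head_vec d (a - c * t) t)"
  by (simp add: solves_def line_mat_mult_eq_iff)

lemma mat_kernel_line_mat:
  assumes "d \<ge> 2"
  shows "mat_kernel (line_mat d c) = range (\<lambda>t. head_vec d (- (c * t)) t)"
  using line_mat_mult_eq_iff[OF assms, of _ c 0]
  by (auto simp: mat_kernel_def zero_vec_eq_head_vec)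

section \<open>The two null space constants\<close>

lemma mat_kernel_line_mat_nonzero:
  assumes "d \<ge> 2"
  shows "mat_kernel (line_mat d c) - {0\<^sub>v d} = (\<lambda>t. head_vec d (- (c * t)) t) ` (- {0})"
  using assms by (auto simp: mat_kernel_line_mat zero_vec_eq_head_vec head_vec_eq_iff)

text \<open>The support of g is {0} and its sign there is +1, so on the kernel vector t n the
  quotient is \<rho> sgn t. As \<rho> \<ge> 0, the supremum is attained at t = 1.\<close>

lemma nsp_const_line_mat:
  assumes "d \<ge> 2" "\<rho> \<ge> 0"
  shows "nsp_const (line_mat d (\<rho> * (real d - 1))) (head_vec d 1 0) = \<rho>"
proof -
  have "nsp_const (line_mat d (\<rho> * (real d - 1))) (head_vec d 1 0)
      = (SUP t\<in>- {0}. \<rho> * (real d - 1) * t / ((real d - 1) * \<bar>t\<bar>))"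
    using assms by (simp add: nsp_const_def mat_kernel_line_mat_nonzero image_image supp_head_vec
        l1_norm_on_tail_head_vec)
  also have "\<dots> = (SUP t\<in>- {0}. \<rho> * sgn t)"
    using assms by (intro SUP_cong) (auto simp: sgn_if)
  also have "\<dots> = \<rho>"
  proof (rule cSup_eq_maximum)
    show "\<rho> \<in> (\<lambda>t. \<rho> * sgn t) ` (- {0})"
      by (rule image_eqI[of _ _ 1]) auto
  qed (use assms in \<open>auto simp: sgn_if split: if_splits\<close>)
  finally show ?thesis .
qed

text \<open>With the absolute value in the numerator the quotient no longer depends on the sign of t
  and is constantly \<rho>.\<close>

lemma nsp_const_abs_line_mat:
  assumes "d \<ge> 2" "\<rho> \<ge> 0"
  shows "nsp_const_abs (line_mat d (\<rho> * (real d - 1))) (head_vec d 1 0) = \<rho>"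
proof -
  have "nsp_const_abs (line_mat d (\<rho> * (real d - 1))) (head_vec d 1 0)
      = (SUP t\<in>- {0}. \<bar>\<rho> * (real d - 1) * t\<bar> / ((real d - 1) * \<bar>t\<bar>))"
    using assms by (simp add: nsp_const_abs_def mat_kernel_line_mat_nonzero image_image
        supp_head_vec l1_norm_on_tail_head_vec) (simp add: l1_norm_on_def)
  also have "\<dots> = (SUP t\<in>- {0::real}. \<rho>)"
    using assms by (intro SUP_cong) (auto simp: abs_mult)
  also have "\<dots> = \<rho>"
    by (intro cSUP_const) (auto intro: exI[of _ 1])
  finally show ?thesis .
qed

section \<open>Minimizers along the feasible line\<close>

lemma unique_arg_minI:
  fixes f :: "'a \<Rightarrow> real"
  assumes "P x" "\<And>z. P z \<Longrightarrow> z \<noteq> x \<Longrightarrow> f x < f z"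
  shows "unique_arg_min f P x"
  using assms unfolding unique_arg_min_def is_arg_min_def by (metis less_asym)

text \<open>By the mean value theorem f t - f s = (t - s) f'(z) with z strictly between s and t, and
  f'(z) has the same sign as t - s.\<close>

lemma strict_mono_deriv_strict_min:
  fixes f f' :: "real \<Rightarrow> real"
  assumes "\<And>x. (f has_real_derivative f' x) (at x)" "strict_mono f'" "f' s = 0" "t \<noteq> s"
  shows "f s < f t"
proof (cases "s < t")
  case True
  then obtain z where z: "s < z" "f t - f s = (t - s) * f' z"
    using MVT2[of s t f f'] assms(1) by blast
  then show ?thesis
    using strict_monoD[OF assms(2) z(1)] assms(3) True by (smt (verit) mult_pos_pos)
next
  case False
  then have "t < s"
    using assms(4) by simp
  then obtain z where z: "z < s" "f s - f t = (s - t) * f' z"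
    using MVT2[of t s f f'] assms(1) by blast
  then show ?thesis
    using strict_monoD[OF assms(2) z(1)] assms(3) \<open>t < s\<close> by (smt (verit) mult_pos_neg)
qed

text \<open>Moving from g by t n lowers the first entry's absolute value by at most \<rho> (d - 1)
  \<bar>t\<bar> and raises the tail norm by (d - 1) \<bar>t\<bar>, a net gain for t \<noteq> 0
  because \<rho> < 1.\<close>

lemma unique_arg_min_l1_norm_line_mat:
  assumes "d \<ge> 2" "0 \<le> \<rho>" "\<rho> < 1"
  shows "unique_arg_min l1_norm (solves (line_mat d (\<rho> * (real d - 1))) (head_vec d 1 0))
    (head_vec d 1 0)"
proof (rule unique_arg_minI)
  show "solves (line_mat d (\<rho> * (real d - 1))) (head_vec d 1 0) (head_vec d 1 0)"
    using assms by (subst solves_line_mat) (auto intro: exI[of _ 0])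
next
  fix z assume "solves (line_mat d (\<rho> * (real d - 1))) (head_vec d 1 0) z"
    and ne: "z \<noteq> head_vec d 1 0"
  then obtain t where z: "z = head_vec d (1 - \<rho> * (real d - 1) * t) t"
    using assms by (auto simp: solves_line_mat)
  with ne have "t \<noteq> 0"
    by auto
  have "\<rho> * ((real d - 1) * t) \<le> \<rho> * ((real d - 1) * \<bar>t\<bar>)"
    using assms by (intro mult_left_mono) auto
  also have "\<dots> < (real d - 1) * \<bar>t\<bar>"
    using assms \<open>t \<noteq> 0\<close> by simp
  finally have "1 < (1 - \<rho> * ((real d - 1) * t)) + (real d - 1) * \<bar>t\<bar>"
    by simp
  also have "\<dots> \<le> l1_norm z"
    using assms by (simp add: z l1_norm_head_vec mult.assoc)
  finally show "l1_norm (head_vec d 1 0) < l1_norm z"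
    using assms by (simp add: l1_norm_head_vec)
qed

text \<open>Intermediate value theorem on [0, \<alpha> \<open>h_fun D\<close> \<rho>]. At the left
  end the difference of the two sides is - \<rho> \<open>h_inv D\<close> (1 / \<alpha>) \<le> 0; at
  the right end the first term is exactly \<rho>, and the second is at most \<rho> since
  \<open>h_inv\<close> < 1.\<close>

lemma optimality_solution:
  assumes "D \<ge> 3" "0 \<le> \<rho>" "\<rho> < 1" "\<alpha> > 0"
  shows "\<exists>t. 0 \<le> t \<and> t \<le> \<alpha> * h_fun D \<rho> \<and> h_inv D (t / \<alpha>) = \<rho> * h_inv D ((1 - c * t) / \<alpha>)"
proof -
  let ?\<phi> = "\<lambda>t. h_inv D (t / \<alpha>) - \<rho> * h_inv D ((1 - c * t) / \<alpha>)"
  have h0: "0 \<le> h_fun D \<rho>"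
    using h_fun_strict_mono[OF assms(1), of 0 \<rho>] assms(2,3) by (cases "\<rho> = 0") auto
  have cont: "isCont ?\<phi> t" for t
    using assms(4) by (intro continuous_intros isCont_o2[OF _ isCont_h_inv[OF assms(1)]]) auto
  have "?\<phi> 0 \<le> 0"
    using assms h_inv_mono[OF assms(1), of 0 "1 / \<alpha>"] by simp
  moreover have "0 \<le> ?\<phi> (\<alpha> * h_fun D \<rho>)"
    using assms mult_left_le[of "h_inv D u" \<rho> for u] h_inv_bounds(2)[OF assms(1)]
    by (simp add: h_inv_h_fun less_imp_le)
  ultimately have "\<exists>t. 0 \<le> t \<and> t \<le> \<alpha> * h_fun D \<rho> \<and> ?\<phi> t = 0"
    using h0 assms(4) cont by (intro IVT) auto
  then show ?thesis
    by auto
qed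

text \<open>Along the feasible line the objective is a function of t whose derivative is d - 1 times
  the defect in the optimality equation. This derivative is strictly increasing, so its zero s is
  the strict minimum.\<close>

lemma unique_arg_min_bregman_line_mat:
  assumes "D \<ge> 3" "d \<ge> 2" "0 \<le> \<rho>" "\<alpha> > 0"
    and s: "h_inv D (s / \<alpha>) = \<rho> * h_inv D ((1 - \<rho> * (real d - 1) * s) / \<alpha>)"
  shows "unique_arg_min (\<lambda>z. bregman (Q_fun D \<alpha>) z (0\<^sub>v d))
    (solves (line_mat d (\<rho> * (real d - 1))) (head_vec d 1 0))
    (head_vec d (1 - \<rho> * (real d - 1) * s) s)"
proof (rule unique_arg_minI)
  define c where "c = \<rho> * (real d - 1)"
  have c: "c \<ge> 0"
    using assms by (simp add: c_def)
  define f where "f t = \<alpha> * q_fun D ((1 - c * t) / \<alpha>) + (real d - 1) * (\<alpha> * q_fun D (t / \<alpha>))" for t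
  \<comment> \<open>The chain rule produces the weights d - 1 and c; since c = \<rho> (d - 1), the
    factor d - 1 comes out and leaves the optimality equation in terms of \<rho>.\<close>
  define f' where "f' t = (real d - 1) * (h_inv D (t / \<alpha>) - \<rho> * h_inv D ((1 - c * t) / \<alpha>))" for t
  have f: "bregman (Q_fun D \<alpha>) (head_vec d (1 - c * t) t) (0\<^sub>v d) = f t" for t
    using assms by (simp add: bregman_Q_fun Q_fun_head_vec f_def)
  have deriv: "(f has_real_derivative f' t) (at t)" for t
  proof -
    have "(f has_real_derivative \<alpha> * (h_inv D ((1 - c * t) / \<alpha>) * (- c / \<alpha>))
        + (real d - 1) * (\<alpha> * (h_inv D (t / \<alpha>) * (1 / \<alpha>)))) (at t)"
      unfolding f_def[abs_def] using assms by (auto intro!: derivative_eq_intros)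
    moreover have "f' t = (real d - 1) * h_inv D (t / \<alpha>) - c * h_inv D ((1 - c * t) / \<alpha>)"
      by (simp only: f'_def right_diff_distrib) (simp add: c_def)
    ultimately show ?thesis
      using assms(4) by (simp add: mult.commute)
  qed
  have "strict_mono f'"
  proof (rule strict_monoI)
    fix t u :: real assume "t < u"
    then have "h_inv D (t / \<alpha>) < h_inv D (u / \<alpha>)"
      using assms by (intro h_inv_strict_mono divide_strict_right_mono)
    \<comment> \<open>This term is only weakly monotone, as c and \<rho> may vanish; the strictness
      comes from \<open>h_inv D (t / \<alpha>)\<close>.\<close>
    moreover have "(1 - c * u) / \<alpha> \<le> (1 - c * t) / \<alpha>"
      using assms \<open>t < u\<close> c by (intro divide_right_mono diff_left_mono mult_left_mono) auto
    then have "\<rho> * h_inv D ((1 - c * u) / \<alpha>) \<le> \<rho> * h_inv D ((1 - c * t) / \<alpha>)"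
      using assms by (intro mult_left_mono h_inv_mono)
    ultimately show "f' t < f' u"
      using assms unfolding f'_def by (intro mult_strict_left_mono) auto
  qed
  moreover have "f' s = 0"
    using s by (simp add: f'_def c_def)
  ultimately have min: "f s < f t" if "t \<noteq> s" for t
    using strict_mono_deriv_strict_min[of f f'] deriv that by blast
  show "solves (line_mat d (\<rho> * (real d - 1))) (head_vec d 1 0)
      (head_vec d (1 - \<rho> * (real d - 1) * s) s)"
    using assms by (auto simp: solves_line_mat)
  fix z assume "solves (line_mat d (\<rho> * (real d - 1))) (head_vec d 1 0) z"
    and ne: "z \<noteq> head_vec d (1 - \<rho> * (real d - 1) * s) s"
  then obtain t where z: "z = head_vec d (1 - c * t) t"
    using assms by (auto simp: solves_line_mat c_def)
  with ne have "t \<noteq> s"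
    by (auto simp: c_def)
  then show "bregman (Q_fun D \<alpha>) (head_vec d (1 - \<rho> * (real d - 1) * s) s) (0\<^sub>v d)
      < bregman (Q_fun D \<alpha>) z (0\<^sub>v d)"
    using min[of t] f unfolding z c_def by simp
qed

lemma optimality_solution_asymptotics:
  assumes "D \<ge> 3" "0 \<le> \<rho>" "\<rho> < 1" "0 \<le> c"
    and t: "\<And>\<alpha>. \<alpha> > 0 \<Longrightarrow> 0 \<le> t \<alpha> \<and> t \<alpha> \<le> \<alpha> * h_fun D \<rho>
      \<and> h_inv D (t \<alpha> / \<alpha>) = \<rho> * h_inv D ((1 - c * t \<alpha>) / \<alpha>)"
  shows "((\<lambda>\<alpha>. t \<alpha> / \<alpha>) \<longlongrightarrow> h_fun D \<rho>) (at_right 0)"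
proof -
  have pos: "\<forall>\<^sub>F \<alpha> in at_right 0. \<alpha> > (0 :: real)"
    by (rule eventually_at_right_less)
  \<comment> \<open>This lower bound for (1 - c t) / \<alpha> results from inserting t \<le>
    \<alpha> \<open>h_fun D\<close> \<rho>; the linear bound on t keeps the loss bounded while 1 /
    \<alpha> diverges.\<close>
  have "filterlim (\<lambda>\<alpha>. - (c * h_fun D \<rho>) + inverse \<alpha>) at_top (at_right 0)"
    by (rule filterlim_tendsto_add_at_top[OF tendsto_const filterlim_inverse_at_top_right])
  moreover have "\<forall>\<^sub>F \<alpha> in at_right 0. - (c * h_fun D \<rho>) + inverse \<alpha> \<le> (1 - c * t \<alpha>) / \<alpha>"
    using pos
  proof eventually_elim
    case (elim \<alpha>)
    then have "c * t \<alpha> \<le> c * (\<alpha> * h_fun D \<rho>)"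
      using t assms(4) by (intro mult_left_mono) auto
    then show ?case
      using elim by (simp add: field_simps)
  qed
  ultimately have "filterlim (\<lambda>\<alpha>. (1 - c * t \<alpha>) / \<alpha>) at_top (at_right 0)"
    by (rule filterlim_at_top_mono)
  then have "((\<lambda>\<alpha>. \<rho> * h_inv D ((1 - c * t \<alpha>) / \<alpha>)) \<longlongrightarrow> \<rho> * 1) (at_right 0)"
    by (intro tendsto_mult tendsto_const filterlim_compose[OF h_inv_tendsto_1[OF assms(1)]])
  \<comment> \<open>The limit \<rho> < 1 lies inside the domain, where \<open>h_fun\<close> is
    continuous. By the optimality equation the argument of \<open>h_fun\<close> is
    \<open>h_inv D (t \<alpha> / \<alpha>)\<close>, so the left-hand side is t / \<alpha>.\<close>
  then have "((\<lambda>\<alpha>. h_fun D (\<rho> * h_inv D ((1 - c * t \<alpha>) / \<alpha>))) \<longlongrightarrow> h_fun D \<rho>) (at_right 0)"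
    using isCont_tendsto_compose[OF isCont_h_fun[of \<rho> D]] assms(2,3) by simp
  moreover have "\<forall>\<^sub>F \<alpha> in at_right 0. h_fun D (\<rho> * h_inv D ((1 - c * t \<alpha>) / \<alpha>)) = t \<alpha> / \<alpha>"
    using pos by eventually_elim (metis t h_fun_h_inv assms(1))
  ultimately show ?thesis
    by (rule Lim_transform_eventually)
qed

theorem proposition2p9:
  fixes D d :: nat and \<rho> :: real
  assumes "D \<ge> 3" and "d \<ge> 3" and "0 \<le> \<rho>" and "\<rho> < 1"
  shows "\<exists>N A y g. A \<in> carrier_mat N d \<and> y \<in> carrier_vec N \<and>
    unique_arg_min l1_norm (solves A y) g \<and>
    g \<noteq> 0\<^sub>v d \<and> mat_kernel A \<noteq> {0\<^sub>v d} \<and>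
    nsp_const A g = \<rho> \<and>
    (\<exists>x :: real \<Rightarrow> real vec.
      (\<forall>\<alpha>>0. unique_arg_min (\<lambda>z. bregman (Q_fun D \<alpha>) z (0\<^sub>v d)) (solves A y) (x \<alpha>)) \<and>
      (let Sc = {..<d} - supp g in
        ((\<lambda>\<alpha>. l1_norm (x \<alpha> - g) / (\<alpha> * real (card Sc) * (1 + nsp_const_abs A g)))
           \<longlongrightarrow> h_fun D \<rho>) (at_right 0) \<and>
        ((\<lambda>\<alpha>. linf_norm_on Sc (x \<alpha> - g) / \<alpha>) \<longlongrightarrow> h_fun D \<rho>) (at_right 0)))"
proof -
  define c where "c = \<rho> * (real d - 1)"
  \<comment> \<open>The matrix is square, so N = d, and it fixes \<open>?g\<close>, which therefore
    serves both as the right-hand side y and as the l1 minimizer.\<close>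
  let ?A = "line_mat d c" and ?g = "head_vec d 1 0" and ?Sc = "{..<d} - {0::nat}"
  have d: "d \<ge> 1" "d \<ge> 2" and c: "c \<ge> 0"
    using assms by (auto simp: c_def)
  have "\<exists>t. \<forall>\<alpha>>0. 0 \<le> t \<alpha> \<and> t \<alpha> \<le> \<alpha> * h_fun D \<rho>
      \<and> h_inv D (t \<alpha> / \<alpha>) = \<rho> * h_inv D ((1 - c * t \<alpha>) / \<alpha>)"
    using optimality_solution[OF assms(1,3,4)] by (intro choice) blast
  then obtain t where t: "\<And>\<alpha>. \<alpha> > 0 \<Longrightarrow> 0 \<le> t \<alpha> \<and> t \<alpha> \<le> \<alpha> * h_fun D \<rho>
      \<and> h_inv D (t \<alpha> / \<alpha>) = \<rho> * h_inv D ((1 - c * t \<alpha>) / \<alpha>)"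
    by blast
  define x where "x \<alpha> = head_vec d (1 - c * t \<alpha>) (t \<alpha>)" for \<alpha>
  have lim: "((\<lambda>\<alpha>. t \<alpha> / \<alpha>) \<longlongrightarrow> h_fun D \<rho>) (at_right 0)"
    using optimality_solution_asymptotics[OF assms(1,3,4) c t] .
  \<comment> \<open>The chosen t is unconstrained for \<alpha> \<le> 0, so the identities below hold
    only eventually, which suffices for the one-sided limit.\<close>
  have pos: "\<forall>\<^sub>F \<alpha> in at_right 0. \<alpha> > (0 :: real)"
    by (rule eventually_at_right_less)
  have supp: "supp ?g = {0}"
    using d by (simp add: supp_head_vec)
  have diff: "x \<alpha> - ?g = head_vec d (- (c * t \<alpha>)) (t \<alpha>)" for \<alpha>
    by (simp add: x_def head_vec_diff)
  have nsp_abs: "nsp_const_abs ?A ?g = \<rho>"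
    using nsp_const_abs_line_mat[OF d(2) assms(3)] by (simp add: c_def)
  have l1: "l1_norm (x \<alpha> - ?g) / (\<alpha> * real (card ?Sc) * (1 + nsp_const_abs ?A ?g)) = t \<alpha> / \<alpha>"
    if "\<alpha> > 0" for \<alpha>
  proof -
    \<comment> \<open>As t \<ge> 0, the norm is c t + (d - 1) t. With c = \<rho> (d - 1) the factor
      (d - 1)(1 + \<rho>) cancels the normalization exactly, so the quotient is t / \<alpha> for
      every \<alpha> > 0 and not only in the limit.\<close>
    have "l1_norm (x \<alpha> - ?g) = t \<alpha> * ((real d - 1) * (1 + \<rho>))"
      using d c t[OF that] by (simp add: diff l1_norm_head_vec abs_mult) (simp add: c_def algebra_simps)
    moreover have "real (card ?Sc) = real d - 1"
      using d by (simp add: of_nat_diff)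
    ultimately show ?thesis
      using d assms(3) by (simp add: nsp_abs)
  qed
  have linf: "linf_norm_on ?Sc (x \<alpha> - ?g) / \<alpha> = t \<alpha> / \<alpha>" if "\<alpha> > 0" for \<alpha>
    using d t[OF that] by (simp add: diff linf_norm_on_tail_head_vec)
  have "((\<lambda>\<alpha>. l1_norm (x \<alpha> - ?g) / (\<alpha> * real (card ?Sc) * (1 + nsp_const_abs ?A ?g)))
      \<longlongrightarrow> h_fun D \<rho>) (at_right 0)"
    by (rule Lim_transform_eventually[OF lim]) (use pos in eventually_elim, use l1 in simp)
  moreover have "((\<lambda>\<alpha>. linf_norm_on ?Sc (x \<alpha> - ?g) / \<alpha>) \<longlongrightarrow> h_fun D \<rho>) (at_right 0)"
    by (rule Lim_transform_eventually[OF lim]) (use pos in eventually_elim, use linf in simp)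
  moreover have "unique_arg_min (\<lambda>z. bregman (Q_fun D \<alpha>) z (0\<^sub>v d)) (solves ?A ?g) (x \<alpha>)"
    if "\<alpha> > 0" for \<alpha>
    using unique_arg_min_bregman_line_mat[OF assms(1) d(2) assms(3) that] t[OF that]
    by (simp add: x_def c_def)
  \<comment> \<open>The spanning vector n itself, that is the parameter t = 1, shows that the kernel
    is nontrivial.\<close>
  moreover have "head_vec d (- c) 1 \<in> mat_kernel ?A - {0\<^sub>v d}"
    using d by (auto simp: mat_kernel_line_mat_nonzero intro: image_eqI[of _ _ 1])
  then have "mat_kernel ?A \<noteq> {0\<^sub>v d}"
    by blast
  moreover have "?g \<noteq> 0\<^sub>v d"
    using d by (simp add: zero_vec_eq_head_vec head_vec_eq_iff)
  moreover have "unique_arg_min l1_norm (solves ?A ?g) ?g"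
    using unique_arg_min_l1_norm_line_mat[OF d(2) assms(3,4)] by (simp add: c_def)
  moreover have "nsp_const ?A ?g = \<rho>"
    using nsp_const_line_mat[OF d(2) assms(3)] by (simp add: c_def)
  ultimately show ?thesis
    by (intro exI[of _ d] exI[of _ ?A] exI[of _ ?g] conjI exI[of _ x])
      (simp_all add: supp Let_def)
qed

end
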